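(* Let $S\subset\mathbb{R}^d$ be a compact set, let $X_1,X_2,\dots$ be iid random vectors with a distribution $P$ whose support is $S$, and let $\mathbb{P}_n$ be the empirical measure of $\aleph_n=\{X_1,\dots,X_n\}$. (a) Let $x\in S$ be such that $\dim_{\mathrm{pw}}(x)$ exists and suppose there are positive constants $r_0,\delta,d'$ such that $P(B(x,r))\ge\delta r^{d'}$ for all $r\in(0,r_0)$. Then, for $r_n=(C\log(n)/n)^{1/d'}$ with $C>28/(3\delta)$, the estimator $\widehat{\dim}_{\mathrm{pw}}(x)=\frac{\log(\mathbb{P}_n(B(x,r_n)))}{\log(r_n)}$ is almost surely consistent, that is, $$\dim_{\mathrm{pw}}(x)=\lim_{n\to\infty}\frac{\log(\mathbb{P}_n(B(x,r_n)))}{\log(r_n)}\quad\text{a.s.}$$ (b) Assume now that there are positive constants $r_0,\delta,d'$ such that $P(B(x,r))\ge\delta r^{d'}$ for all $x\in S$ and all $r\in(0,r_0)$, and that $\dim_{\mathrm{pw}}(x)$ exists for all $x\in S$. Let $\beta>(4d+12)/\delta^2$ and $$r_n=\left(\beta\frac{\log n}{n}\right)^{\frac{1}{2d'}}.$$ If the convergence $\frac{\log(P(B(x,r)))}{\log(r)}\to\dim_{\mathrm{pw}}(x)$ as $r\to0$ is uniform in $x\in S$, then, with $\widehat{\dim}_{\mathrm{pw}}(x)=\frac{\log(\mathbb{P}_n(B(x,r_n)))}{\log(r_n)}$ for this $r_n$, $$\sup_{x\in S}\left|\widehat{\dim}_{\mathrm{pw}}(x)-\dim_{\mathrm{pw}}(x)\right|\to0\quad\text{almost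 surely, as }n\to\infty.$$ As a consequence, almost surely, as $n\to\infty$, $$\sup_{x\in S}\widehat{\dim}_{\mathrm{pw}}(x)\to\sup_{x\in S}\dim_{\mathrm{pw}}(x)\ge\dim_{\mathrm{H}}(S)\quad\text{and}\quad\inf_{x\in S}\widehat{\dim}_{\mathrm{pw}}(x)\to\inf_{x\in S}\dim_{\mathrm{pw}}(x)\le\dim_{\mathrm{H}}(S),$$ where $\dim_{\mathrm{H}}(S)$ is the Hausdorff dimension of $S$.
   Context: $B(x,r)$ is the closed Euclidean ball of centre $x$ and radius $r$ in $\mathbb{R}^d$. For a probability measure $P$ with support $S$ and $x\in S$, the pointwise dimension of $P$ at $x$ is $$\dim_{\mathrm{pw}}(x)=\lim_{r\to0}\frac{\log(P(B(x,r)))}{\log(r)},$$ provided this limit exists (it can be $+\infty$). The Hausdorff dimension is $\dim_{\mathrm{H}}(S)=\inf\{\alpha:\mathcal{H}^\alpha_\infty(S)=0\}$, where $\mathcal{H}^\alpha_\infty(S)=\inf\{\sum_i\mathrm{diam}(U_i)^\alpha: S\subset\bigcup_iU_i\}$, the infimum being over countable covers of $S$. *)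

theory Defs
  imports "HOL-Probability.Probability"
begin

definition measure_support :: "'a::topological_space measure \<Rightarrow> 'a set" where
  "measure_support P = {x. \<forall>U. open U \<and> x \<in> U \<longrightarrow> emeasure P U > 0}"

text \<open>
  The ratio below is the intended one at points \<open>x\<close> of the support, where every ball has
  positive mass. Its limit is taken in the extended reals, so that the pointwise dimension may
  be infinite.
\<close>

definition pw_ratio :: "'a::metric_space measure \<Rightarrow> real \<Rightarrow> 'a \<Rightarrow> real" where
  "pw_ratio P r x = ln (measure P (cball x r)) / ln r"

definition pw_dim_exists :: "'a::metric_space measure \<Rightarrow> 'a \<Rightarrow> bool" where
  "pw_dim_exists P x \<longleftrightarrow> (\<exists>D. ((\<lambda>r. ereal (pw_ratio P r x)) \<longlongrightarrow> D) (at_right 0))"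

definition pw_dim :: "'a::metric_space measure \<Rightarrow> 'a \<Rightarrow> ereal" where
  "pw_dim P x = Lim (at_right 0) (\<lambda>r. ereal (pw_ratio P r x))"

text \<open>
  The sample of size \<open>n\<close> is \<open>X 0, \<dots>, X (n - 1)\<close>, counted with multiplicity.
\<close>

definition empirical :: "(nat \<Rightarrow> 'w \<Rightarrow> 'a) \<Rightarrow> 'w \<Rightarrow> nat \<Rightarrow> 'a set \<Rightarrow> real" where
  "empirical X \<omega> n A = real (card {i. i < n \<and> X i \<omega> \<in> A}) / real n"

text \<open>
  A ball may contain no sample point, so the logarithm of the empirical mass is extended by
  \<open>log 0 = -\<infinity>\<close>; for \<open>0 < r < 1\<close> the estimator is then \<open>\<infinity>\<close>. (The real function \<^const>\<open>ln\<close> of the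
  library has \<open>ln 0 = 0\<close>, which would make the estimator \<open>0\<close> there.)
\<close>

definition ext_ln :: "real \<Rightarrow> ereal" where
  "ext_ln q = (if q \<le> 0 then -\<infinity> else ereal (ln q))"

definition pw_dim_est ::
    "(nat \<Rightarrow> 'w \<Rightarrow> 'a::metric_space) \<Rightarrow> 'w \<Rightarrow> nat \<Rightarrow> real \<Rightarrow> 'a \<Rightarrow> ereal" where
  "pw_dim_est X \<omega> n r x = ext_ln (empirical X \<omega> n (cball x r)) / ereal (ln r)"

text \<open>
  \<open>diam_pow \<alpha> U\<close> is \<open>diam(U)\<^sup>\<alpha>\<close> with values in \<open>[0, \<infinity>]\<close>. The empty set contributes \<open>0\<close> (so that
  finite covers are included among the sequences of sets), every nonempty set contributes \<open>1\<close> for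
  \<open>\<alpha> = 0\<close>, and unbounded sets contribute \<open>\<infinity>\<close> for \<open>\<alpha> > 0\<close>. The cases are needed because
  \<open>0 powr 0 = 0\<close> and because \<^const>\<open>diameter\<close> is unspecified on unbounded sets.
\<close>

definition diam_pow :: "real \<Rightarrow> 'a::metric_space set \<Rightarrow> ennreal" where
  "diam_pow \<alpha> U =
     (if U = {} then 0
      else if \<alpha> = 0 then 1
      else if bounded U then ennreal (diameter U powr \<alpha>)
      else \<infinity>)"

definition hausdorff_content :: "real \<Rightarrow> 'a::metric_space set \<Rightarrow> ennreal" where
  "hausdorff_content \<alpha> A =
     (INF U \<in> {U :: nat \<Rightarrow> 'a set. A \<subseteq> (\<Union>i. U i)}. \<Sum>i. diam_pow \<alpha> (U i))"

definition hausdorff_dim :: "'a::metric_space set \<Rightarrow> ereal" where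
  "hausdorff_dim A = (INF \<alpha> \<in> {\<alpha>. 0 \<le> \<alpha> \<and> hausdorff_content \<alpha> A = 0}. ereal \<alpha>)"

end

theory Submission
  imports Defs "HOL-Real_Asymp.Real_Asymp"
begin

text \<open>
  A Chernoff bound for the empirical mass of a set, with the multiplicative errors \<open>1/2\<close> and \<open>2\<close>,
  and the Borel-Cantelli lemma give \<open>p/2 \<le> P\<^sub>n(A) \<le> 2p\<close> with \<open>p = P(A)\<close>, eventually and
  simultaneously for all sets \<open>A\<close> of a finite family, provided \<open>np\<close> is large compared to
  \<open>log n\<close>. A bounded factor in the mass is negligible after division by \<open>log r\<^sub>n\<close>, which is (a).
  For (b) this is applied to balls centred at a finite net of \<open>S\<close>: disjoint balls of mass at least
  \<open>m\<close> number at most \<open>1/m\<close>, so a net at scale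
  \<open>r\<^sub>n\<close> has polynomially many points in \<open>1/r\<^sub>n\<close>. The same count bounds
  \<open>dim\<^sub>H(S)\<close> from above, and the mass distribution principle bounds it from below.
\<close>

section \<open>Chernoff bounds and almost sure control of the empirical mass\<close>

lemma empirical_mono: "A \<subseteq> B \<Longrightarrow> empirical X \<omega> n A \<le> empirical X \<omega> n B"
  unfolding empirical_def by (intro divide_right_mono of_nat_mono card_mono) auto

lemma empirical_eq_sum:
  "empirical X \<omega> n A = (\<Sum>i<n. indicat_real A (X i \<omega>)) / real n"
proof -
  have "{i. i < n \<and> X i \<omega> \<in> A} = {i\<in>{..<n}. X i \<omega> \<in> A}" by auto
  then show ?thesis
    by (simp add: empirical_def indicator_def sum.If_cases Int_def)
qed

context prob_space
begin

context
  fixes X :: "nat \<Rightarrow> 'a \<Rightarrow> 'b::topological_space" and P :: "'b measure"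
  assumes indep: "indep_vars (\<lambda>_. borel) X UNIV"
    and distr_eq: "\<And>i. distr M borel (X i) = P"
begin

lemma random_variable_sample [measurable]: "random_variable borel (X i)"
  using indep by (auto simp: indep_vars_def)

lemma empirical_measurable:
  assumes [measurable]: "A \<in> sets borel"
  shows "(\<lambda>\<omega>. empirical X \<omega> n A) \<in> borel_measurable M"
  unfolding empirical_eq_sum by measurable

lemma prob_sample:
  assumes "A \<in> sets borel"
  shows "prob {\<omega> \<in> space M. X i \<omega> \<in> A} = measure P A"
  by (simp add: distr_eq[of i, symmetric] measure_distr[OF random_variable_sample assms]
      vimage_def Int_def conj_commute)

text \<open>The moment generating function of a binomial count, with base \<open>b\<close> in place
  of an exponential. Since \<open>b\<close> raised to an indicator is \<open>1 + (b - 1)\<close>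
  times that indicator, up to the constant term, the power is a product of independent factors of
  expectation \<open>1 + (b - 1) * p\<close>, each at most \<open>exp ((b - 1) * p)\<close>.\<close>

lemma
  fixes b :: real
  assumes A: "A \<in> sets borel" and b: "0 < b"
  shows expectation_powr_count_le:
      "expectation (\<lambda>\<omega>. b powr (\<Sum>i<n. indicat_real A (X i \<omega>))) \<le> exp ((b - 1) * (real n * measure P A))"
    and integrable_powr_count:
      "integrable M (\<lambda>\<omega>. b powr (\<Sum>i<n. indicat_real A (X i \<omega>)))"
proof -
  define p where "p = measure P A"
  define g where "g y = (1::real) + (b - 1) * indicator A y" for y
  have [measurable]: "A \<in> sets borel" by fact
  have gm: "g \<in> borel_measurable borel" unfolding g_def by measurable
  have eq: "b powr (\<Sum>i<n. indicat_real A (X i \<omega>)) = (\<Prod>i<n. g (X i \<omega>))" for \<omega>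
    using b by (induction n) (auto simp: powr_add g_def indicator_def)
  have ind: "indep_vars (\<lambda>_. borel) (\<lambda>i \<omega>. g (X i \<omega>)) {..<n}"
    using gm by (intro indep_vars_compose2[OF indep_vars_subset[OF indep]]) auto
  have int1: "integrable M (\<lambda>\<omega>. indicat_real A (X i \<omega>))" for i
    by (intro integrable_const_bound[where B=1]) auto
  have int: "integrable M (\<lambda>\<omega>. g (X i \<omega>))" for i
    unfolding g_def by (intro Bochner_Integration.integrable_add integrable_mult_right int1) auto
  have "expectation (\<lambda>\<omega>. indicat_real A (X i \<omega>)) = p" for i
  proof -
    have "expectation (\<lambda>\<omega>. indicat_real A (X i \<omega>))
        = expectation (indicat_real {\<omega> \<in> space M. X i \<omega> \<in> A})"
      by (intro Bochner_Integration.integral_cong) (auto simp: indicator_def)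
    then show ?thesis using prob_sample[OF A, of i] by (simp add: p_def)
  qed
  then have E: "expectation (\<lambda>\<omega>. g (X i \<omega>)) = 1 + (b - 1) * p" for i
    unfolding g_def using int1[of i] by (simp add: prob_space)
  have p01: "0 \<le> p" "p \<le> 1"
    by (simp_all add: p_def prob_sample[OF A, of 0, symmetric])
  \<comment> \<open>A weighted mean of \<open>1\<close> and \<open>b\<close>, hence nonnegative;
    this allows the bound \<open>1 + t \<le> exp t\<close> to be raised to the power
    \<open>n\<close>.\<close>
  have "1 + (b - 1) * p = (1 - p) + b * p" by (simp add: algebra_simps)
  also have "\<dots> \<ge> 0" using p01 b by simp
  finally have nn: "0 \<le> 1 + (b - 1) * p" .
  have "expectation (\<lambda>\<omega>. \<Prod>i<n. g (X i \<omega>)) = (\<Prod>i<n. expectation (\<lambda>\<omega>. g (X i \<omega>)))"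
    by (intro indep_vars_lebesgue_integral ind int) auto
  also have "\<dots> = (1 + (b - 1) * p) ^ n" by (simp add: E)
  also have "\<dots> \<le> exp ((b - 1) * p) ^ n"
    using nn exp_ge_add_one_self[of "(b - 1) * p"] by (intro power_mono) auto
  also have "\<dots> = exp ((b - 1) * (real n * p))"
    by (simp add: exp_of_nat_mult[symmetric] mult_ac)
  finally show "expectation (\<lambda>\<omega>. b powr (\<Sum>i<n. indicat_real A (X i \<omega>))) \<le> exp ((b - 1) * (real n * measure P A))"
    by (simp add: eq p_def)
  show "integrable M (\<lambda>\<omega>. b powr (\<Sum>i<n. indicat_real A (X i \<omega>)))"
    unfolding eq by (intro indep_vars_integrable ind int) auto
qed

text \<open>Markov's inequality for the power of \<open>b\<close>. For \<open>b > 1\<close> the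
  event is an upper tail of the count; for \<open>b < 1\<close> the power decreases in the count, so
  the same event is a lower tail.\<close>

lemma prob_powr_count_ge_le:
  fixes b :: real
  assumes A: "A \<in> sets borel" and b: "0 < b"
  shows "prob {\<omega> \<in> space M. b powr (\<Sum>i<n. indicat_real A (X i \<omega>)) \<ge> b powr (s * (real n * measure P A))}
    \<le> exp ((b - 1 - s * ln b) * (real n * measure P A))"
    (is "?L \<le> _")
proof -
  have "?L \<le> expectation (\<lambda>\<omega>. b powr (\<Sum>i<n. indicat_real A (X i \<omega>))) / b powr (s * (real n * measure P A))"
    using b by (intro integral_Markov_inequality_measure[where A="{}"] integrable_powr_count A) auto
  also have "\<dots> \<le> exp ((b - 1) * (real n * measure P A)) / b powr (s * (real n * measure P A))"
    using expectation_powr_count_le[OF A b] by (intro divide_right_mono) auto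
  also have "\<dots> = exp ((b - 1 - s * ln b) * (real n * measure P A))"
    using b by (simp add: powr_def exp_diff[symmetric] algebra_simps)
  finally show ?thesis .
qed

text \<open>The upper tail takes \<open>b = s = 2\<close> and the lower tail
  \<open>b = s = 1/2\<close> in the preceding bound: for given \<open>s\<close>, the choice
  \<open>b = s\<close> minimises the exponent \<open>b - 1 - s * ln b\<close>.\<close>

lemma chernoff_empirical:
  assumes A: "A \<in> sets borel"
  shows "prob {\<omega> \<in> space M. \<not> (measure P A / 2 \<le> empirical X \<omega> n A \<and> empirical X \<omega> n A \<le> 2 * measure P A)}
     \<le> 2 * exp (- (11/72) * (real n * measure P A))" (is "prob ?B \<le> _")
proof (cases "n = 0")
  case True
  then have "2 * exp (- (11/72) * (real n * measure P A)) = 2" by simp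
  then show ?thesis using prob_le_1[of ?B] by linarith
next
  case False
  define q where "q = real n * measure P A"
  define Z where "Z \<omega> = (\<Sum>i<n. indicat_real A (X i \<omega>))" for \<omega>
  have [measurable]: "A \<in> sets borel" by fact
  have [measurable]: "Z \<in> borel_measurable M" unfolding Z_def by measurable
  have q0: "q \<ge> 0" by (simp add: q_def)
  let ?U = "{\<omega> \<in> space M. 2 powr Z \<omega> \<ge> (2::real) powr (2 * q)}"
  let ?L = "{\<omega> \<in> space M. (1/2) powr Z \<omega> \<ge> (1/2::real) powr ((1/2) * q)}"
  have Z: "empirical X \<omega> n A = Z \<omega> / real n" for \<omega> by (simp add: empirical_eq_sum Z_def)
  have "?B \<subseteq> ?L \<union> ?U"
  proof
    fix \<omega> assume w: "\<omega> \<in> ?B"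
    then have "Z \<omega> < (1/2) * q \<or> Z \<omega> > 2 * q"
      using False by (auto simp: Z q_def field_simps)
    then show "\<omega> \<in> ?L \<union> ?U" using w powr_mono'[of "Z \<omega>" "1/2 * q" "1/2::real"] by auto
  qed
  then have "prob ?B \<le> prob (?L \<union> ?U)" by (intro finite_measure_mono) measurable
  also have "\<dots> \<le> prob ?L + prob ?U" by (intro measure_Un_le) measurable
  also have "\<dots> \<le> exp ((1/2 - 1 - 1/2 * ln (1/2)) * q) + exp ((2 - 1 - 2 * ln 2) * q)"
    using prob_powr_count_ge_le[OF A, of "1/2" "1/2" n] prob_powr_count_ge_le[OF A, of 2 2 n]
    by (intro add_mono) (simp_all add: q_def Z_def)
  \<comment> \<open>The lower-tail exponent is \<open>(ln 2 - 1) / 2\<close>, at most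
    \<open>-11/72\<close> because \<open>ln 2 \<le> 25/36\<close>. The upper-tail exponent
    \<open>1 - 2 * ln 2\<close> is at most \<open>-1/3\<close> because
    \<open>ln 2 \<ge> 2/3\<close>.\<close>
  also have "\<dots> \<le> exp (- (11/72) * q) + exp (- (11/72) * q)"
    using q0 ln2_le_25_over_36 ln2_ge_two_thirds
    by (intro add_mono exp_le_cancel_iff[THEN iffD2] mult_right_mono) (auto simp: ln_div)
  finally show ?thesis by (simp add: q_def)
qed

text \<open>A union bound over \<open>\<A> n\<close> costs the factor \<open>k n\<close>, and the
  common lower bound \<open>m n\<close> makes the Chernoff estimate uniform over the family;
  Borel-Cantelli does the rest. The family may vary with \<open>n\<close>, as nets at shrinking
  scales do.\<close>

lemma AE_eventually_empirical_comparable: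
  assumes ev: "\<forall>\<^sub>F n in sequentially. finite (\<A> n) \<and> real (card (\<A> n)) \<le> k n
      \<and> (\<forall>A\<in>\<A> n. A \<in> sets borel \<and> m n \<le> measure P A)"
    and summable: "summable (\<lambda>n. k n * exp (- (11/72) * (real n * m n)))"
  shows "AE \<omega> in M. \<forall>\<^sub>F n in sequentially. \<forall>A\<in>\<A> n.
    measure P A / 2 \<le> empirical X \<omega> n A \<and> empirical X \<omega> n A \<le> 2 * measure P A"
proof -
  define bad where "bad n A = {\<omega> \<in> space M. \<not> (measure P A / 2 \<le> empirical X \<omega> n A \<and>
      empirical X \<omega> n A \<le> 2 * measure P A)}" for n A
  obtain N where N: "\<And>n. n \<ge> N \<Longrightarrow> finite (\<A> n) \<and> real (card (\<A> n)) \<le> k n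
      \<and> (\<forall>A\<in>\<A> n. A \<in> sets borel \<and> m n \<le> measure P A)"
    using ev unfolding eventually_sequentially by auto
  \<comment> \<open>Before \<open>N\<close> nothing is known about finiteness or measurability of
    \<open>\<A> n\<close>; the empty event there keeps every \<open>E n\<close> measurable.\<close>
  define E where "E n = (if n \<ge> N then \<Union>A\<in>\<A> n. bad n A else {})" for n
  have bad[measurable]: "bad n A \<in> events" if [measurable]: "A \<in> sets borel" for n A
  proof -
    note [measurable] = empirical_measurable[OF that]
    show ?thesis unfolding bad_def by measurable
  qed
  have E: "E n \<in> events" for n
    unfolding E_def using N[of n] by (auto intro!: sets.finite_UN bad)
  have le: "prob (E n) \<le> 2 * (k n * exp (- (11/72) * (real n * m n)))" if "n \<ge> N" for n
  proof -
    have fin: "finite (\<A> n)" and k: "real (card (\<A> n)) \<le> k n"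
      and A: "\<And>A. A \<in> \<A> n \<Longrightarrow> A \<in> sets borel" "\<And>A. A \<in> \<A> n \<Longrightarrow> m n \<le> measure P A"
      using N[OF that] by auto
    have "prob (E n) \<le> (\<Sum>A\<in>\<A> n. prob (bad n A))"
      using fin A that unfolding E_def by (auto intro!: finite_measure_subadditive_finite bad)
    also have "\<dots> \<le> (\<Sum>A\<in>\<A> n. 2 * exp (- (11/72) * (real n * m n)))"
    proof (rule sum_mono)
      fix B assume B: "B \<in> \<A> n"
      have "prob (bad n B) \<le> 2 * exp (- (11/72) * (real n * measure P B))"
        unfolding bad_def by (intro chernoff_empirical A B)
      also have "\<dots> \<le> 2 * exp (- (11/72) * (real n * m n))"
        using A(2)[OF B] by (simp add: mult_left_mono)
      finally show "prob (bad n B) \<le> 2 * exp (- (11/72) * (real n * m n))" .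
    qed
    also have "\<dots> = real (card (\<A> n)) * (2 * exp (- (11/72) * (real n * m n)))" by simp
    also have "\<dots> \<le> k n * (2 * exp (- (11/72) * (real n * m n)))"
      using k by (intro mult_right_mono) auto
    finally show ?thesis by (simp add: mult_ac)
  qed
  have "summable (\<lambda>n. prob (E n))"
    by (rule summable_comparison_test_ev[OF _ summable_mult[OF summable, of 2]])
       (use le in \<open>auto simp: eventually_sequentially intro!: exI[of _ N]\<close>)
  then have "AE \<omega> in M. \<forall>\<^sub>F n in sequentially. \<omega> \<in> space M - E n"
    by (intro borel_cantelli_AE1 E) (auto simp: less_top[symmetric])
  then show ?thesis
  proof (rule AE_mp, intro AE_I2 impI)
    fix \<omega> assume "\<forall>\<^sub>F n in sequentially. \<omega> \<in> space M - E n"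
    then show "\<forall>\<^sub>F n in sequentially. \<forall>A\<in>\<A> n.
        measure P A / 2 \<le> empirical X \<omega> n A \<and> empirical X \<omega> n A \<le> 2 * measure P A"
      using eventually_ge_at_top[of N] by eventually_elim (auto simp: E_def bad_def)
  qed
qed

end

end

section \<open>Summability of the tail bounds\<close>

lemma summable_exp_minus_ln:
  fixes s :: real
  assumes "s > 1"
  shows "summable (\<lambda>n. exp (- s * ln (real n)))"
proof -
  have "\<forall>\<^sub>F n in sequentially. exp (- s * ln (real n)) = real n powr - s"
    using eventually_gt_at_top[of 0] by eventually_elim (simp add: powr_def)
  then show ?thesis
    using assms summable_real_powr_iff[of "- s"] by (simp cong: summable_cong)
qed

text \<open>Here \<open>u = (\<beta> * ln n / n) powr (1/2)\<close> is, up to constants, the least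
  mass in a family of about \<open>1 / u\<close> balls. Since \<open>n * u\<close> is the square
  root of \<open>\<beta> * n * ln n\<close>, the exponential beats every power of \<open>n\<close>,
  while \<open>1 / u\<close> grows more slowly than the square root of \<open>n\<close>.\<close>

lemma summable_net_tail:
  fixes c K \<beta> :: real
  assumes "c > 0" "\<beta> > 0"
  shows "summable (\<lambda>n. K / (\<beta> * (ln (real n) / real n)) powr (1/2) * exp (- c * (real n * (\<beta> * (ln (real n) / real n)) powr (1/2))))"
proof (rule summable_comparison_test_bigo)
  show "summable (\<lambda>n. norm (real n powr -2))" by (simp add: summable_real_powr_iff)
  show "(\<lambda>n. K / (\<beta> * (ln (real n) / real n)) powr (1/2) * exp (- c * (real n * (\<beta> * (ln (real n) / real n)) powr (1/2)))) \<in> O(\<lambda>n. real n powr -2)"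
    using assms by real_asymp
qed

section \<open>Support, finite nets and bounds on the Hausdorff dimension\<close>

lemma emeasure_measure_support_compl:
  fixes P :: "'a::second_countable_topology measure"
  assumes sets: "sets P = sets borel"
  shows "emeasure P (- measure_support P) = 0"
proof -
  define \<F> where "\<F> = {U. open U \<and> emeasure P U = 0}"
  \<comment> \<open>The complement of the support is the union of all open null sets; by Lindelof
    countably many of them suffice, so the union is null.\<close>
  obtain \<G> where \<G>: "\<G> \<subseteq> \<F>" "countable \<G>" "\<Union>\<G> = \<Union>\<F>"
    by (rule Lindelof[of \<F>]) (auto simp: \<F>_def)
  have "\<Union>\<G> \<in> null_sets P"
    using \<G> sets
    by (intro null_sets_UN'[of \<G> "\<lambda>U. U", simplified]) (auto simp: \<F>_def null_sets_def)
  moreover have "- measure_support P = \<Union>\<F>"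
    by (auto simp: measure_support_def \<F>_def zero_less_iff_neq_zero)
  ultimately show ?thesis using \<G> by auto
qed

text \<open>Take a subset of \<open>S\<close> of maximal size with mutual distances above
  \<open>2 * \<epsilon>\<close>. Its \<open>\<epsilon>\<close>-balls are disjoint and each has mass
  at least \<open>m\<close>, so there are at most \<open>1 / m\<close> of them, which also shows
  that a maximal size exists. A point of \<open>S\<close> farther than \<open>2 * \<epsilon>\<close>
  from all of them could be added.\<close>

lemma finite_net_of_ball_mass:
  fixes P :: "'a::metric_space measure"
  assumes "prob_space P" and sets: "sets P = sets borel" and "0 \<le> \<epsilon>" "0 < m"
    and mass: "\<And>x. x \<in> S \<Longrightarrow> m \<le> measure P (cball x \<epsilon>)"
  obtains T where "T \<subseteq> S" "finite T" "real (card T) \<le> 1 / m"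
    "\<And>x. x \<in> S \<Longrightarrow> \<exists>y\<in>T. dist x y \<le> 2 * \<epsilon>"
proof -
  interpret prob_space P by fact
  define sep where "sep T \<longleftrightarrow> T \<subseteq> S \<and> finite T \<and> pairwise (\<lambda>x y. 2 * \<epsilon> < dist x y) T" for T
  have card: "real (card T) \<le> 1 / m" if "sep T" for T
  proof -
    have disj: "disjoint_family_on (\<lambda>x. cball x \<epsilon>) T"
      unfolding disjoint_family_on_def
    proof (intro ballI impI)
      fix x y assume "x \<in> T" "y \<in> T" "x \<noteq> y"
      then have "2 * \<epsilon> < dist x y" using that by (auto simp: sep_def pairwise_def)
      then have False if "dist x z \<le> \<epsilon>" "dist y z \<le> \<epsilon>" for z
        using that dist_triangle2[of x y z] by linarith
      then show "cball x \<epsilon> \<inter> cball y \<epsilon> = {}" by auto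
    qed
    have "real (card T) * m = (\<Sum>x\<in>T. m)" by simp
    also have "\<dots> \<le> (\<Sum>x\<in>T. prob (cball x \<epsilon>))"
      using that mass by (intro sum_mono) (auto simp: sep_def)
    also have "\<dots> = prob (\<Union>x\<in>T. cball x \<epsilon>)"
      using that disj by (intro finite_measure_finite_Union[symmetric]) (auto simp: sep_def sets)
    also have "\<dots> \<le> 1" by simp
    finally show ?thesis using \<open>0 < m\<close> by (simp add: field_simps)
  qed
  have "\<exists>T. sep T \<and> (\<forall>T'. sep T' \<longrightarrow> card T' \<le> card T)"
  proof (rule ex_has_greatest_nat)
    show "sep {}" by (simp add: sep_def)
    show "\<forall>T. sep T \<longrightarrow> card T < Suc (nat \<lfloor>1 / m\<rfloor>)"
      using card by (auto simp: le_nat_floor less_Suc_eq_le)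
  qed
  then obtain T where T: "sep T" and max: "\<And>T'. sep T' \<Longrightarrow> card T' \<le> card T"
    by blast
  show ?thesis
  proof
    show "T \<subseteq> S" "finite T" using T by (auto simp: sep_def)
    show "real (card T) \<le> 1 / m" by (rule card[OF T])
    fix x assume x: "x \<in> S"
    show "\<exists>y\<in>T. dist x y \<le> 2 * \<epsilon>"
    proof (rule ccontr)
      assume "\<not> ?thesis"
      then have far: "2 * \<epsilon> < dist x y" if "y \<in> T" for y using that by force
      with \<open>0 \<le> \<epsilon>\<close> have "x \<notin> T" by force
      moreover have "sep (insert x T)"
        using T x far by (auto simp: sep_def pairwise_insert dist_commute)
      ultimately show False using max[of "insert x T"] T by (auto simp: sep_def)
    qed
  qed
qed

text \<open>The finite cover is padded to a sequence by empty sets, for which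
  \<open>diam_pow\<close> is \<open>0\<close>.\<close>

lemma hausdorff_content_le_finite_cover:
  assumes "finite T" "S \<subseteq> (\<Union>y\<in>T. V y)"
  shows "hausdorff_content \<alpha> S \<le> (\<Sum>y\<in>T. diam_pow \<alpha> (V y))"
proof -
  obtain h where h: "bij_betw h {0..<card T} T"
    using ex_bij_betw_nat_finite[OF assms(1)] by blast
  define U where "U i = (if i < card T then V (h i) else {})" for i
  have "S \<subseteq> (\<Union>i. U i)"
  proof
    fix x assume "x \<in> S"
    then obtain y where "y \<in> T" "x \<in> V y" using assms by auto
    moreover then obtain i where "i < card T" "h i = y" using h by (force simp: bij_betw_def)
    ultimately show "x \<in> (\<Union>i. U i)" by (auto simp: U_def intro!: exI[of _ i])
  qed
  then have "hausdorff_content \<alpha> S \<le> (\<Sum>i. diam_pow \<alpha> (U i))"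
    unfolding hausdorff_content_def by (intro INF_lower) auto
  also have "\<dots> = (\<Sum>i\<in>{0..<card T}. diam_pow \<alpha> (U i))"
    by (intro suminf_finite) (auto simp: U_def diam_pow_def)
  also have "\<dots> = (\<Sum>i\<in>{0..<card T}. diam_pow \<alpha> (V (h i)))" by (simp add: U_def)
  also have "\<dots> = (\<Sum>y\<in>T. diam_pow \<alpha> (V y))" by (rule sum.reindex_bij_betw[OF h])
  finally show ?thesis .
qed

text \<open>At scale \<open>r\<close> a net has at most \<open>1 / r powr \<alpha>\<close> points,
  and the balls of radius \<open>2 * r\<close> about them cover \<open>S\<close>. For the exponent
  \<open>\<alpha> + e\<close> their contributions total at most a constant times
  \<open>r powr e\<close>, which tends to \<open>0\<close> with \<open>r\<close>.\<close>

lemma hausdorff_dim_le_of_ball_mass: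
  fixes P :: "'a::euclidean_space measure"
  assumes "prob_space P" "sets P = sets borel" "0 \<le> \<alpha>" "0 < r1"
    and mass: "\<And>x r. x \<in> S \<Longrightarrow> 0 < r \<Longrightarrow> r < r1 \<Longrightarrow> r powr \<alpha> \<le> measure P (cball x r)"
  shows "hausdorff_dim S \<le> ereal \<alpha>"
proof (rule ereal_le_epsilon2)
  fix e :: real assume e: "0 < e"
  define a where "a = \<alpha> + e"
  have a: "0 < a" "\<alpha> < a" using e assms(3) by (auto simp: a_def)
  have le: "hausdorff_content a S \<le> ennreal (4 powr a * r powr e)" if r: "0 < r" "r < r1" for r
  proof -
    obtain T where T: "finite T" "real (card T) \<le> 1 / r powr \<alpha>" "\<And>x. x \<in> S \<Longrightarrow> \<exists>y\<in>T. dist x y \<le> 2 * r"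
      by (rule finite_net_of_ball_mass[of P r "r powr \<alpha>" S]) (use assms r in auto)
    have "hausdorff_content a S \<le> (\<Sum>y\<in>T. diam_pow a (cball y (2 * r)))"
      using T by (intro hausdorff_content_le_finite_cover) (auto simp: dist_commute)
    also have "\<dots> = ennreal (real (card T) * (4 * r) powr a)"
      using a r by (simp add: diam_pow_def ennreal_mult'' ennreal_of_nat_eq_real_of_nat)
    also have "\<dots> \<le> ennreal (1 / r powr \<alpha> * (4 * r) powr a)"
      using T by (intro ennreal_leI mult_right_mono) auto
    also have "1 / r powr \<alpha> * (4 * r) powr a = 4 powr a * r powr e"
      using r by (simp add: a_def powr_mult powr_add field_simps)
    finally show ?thesis .
  qed
  have "((\<lambda>r. ennreal (4 powr a * r powr e)) \<longlongrightarrow> ennreal 0) (at_right 0)"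
  proof (rule tendsto_ennrealI)
    show "((\<lambda>r. 4 powr a * r powr e) \<longlongrightarrow> 0) (at_right 0)"
      using e by real_asymp
  qed
  moreover have "\<forall>\<^sub>F r in at_right 0. hausdorff_content a S \<le> ennreal (4 powr a * r powr e)"
    using le \<open>0 < r1\<close> by (auto simp: eventually_at_right_field)
  ultimately have "hausdorff_content a S \<le> ennreal 0"
    by (rule tendsto_lowerbound) simp
  then have "hausdorff_dim S \<le> ereal a"
    using a unfolding hausdorff_dim_def by (intro INF_lower) auto
  then show "hausdorff_dim S \<le> ereal \<alpha> + ereal e" by (simp add: a_def)
qed

text \<open>The mass distribution principle: for \<open>\<alpha> < \<gamma>\<close> a small covering
  set has mass at most its \<open>diam_pow \<alpha>\<close>, and the masses must add up to at least
  \<open>1\<close>, so the content at \<open>\<alpha>\<close> is bounded away from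
  \<open>0\<close>.\<close>

lemma hausdorff_dim_ge_of_ball_mass:
  fixes P :: "'a::metric_space measure"
  assumes "prob_space P" and sets: "sets P = sets borel" and full: "emeasure P S = 1" and "S \<in> sets borel"
    and "0 < r1"
    and mass: "\<And>x r. x \<in> S \<Longrightarrow> 0 < r \<Longrightarrow> r < r1 \<Longrightarrow> measure P (cball x r) \<le> r powr \<gamma>"
  shows "ereal \<gamma> \<le> hausdorff_dim S"
  unfolding hausdorff_dim_def
proof (rule INF_greatest, rule ccontr)
  interpret prob_space P by fact
  fix \<alpha> assume \<alpha>: "\<alpha> \<in> {\<alpha>. 0 \<le> \<alpha> \<and> hausdorff_content \<alpha> S = 0}" and "\<not> ereal \<gamma> \<le> ereal \<alpha>"
  then have \<alpha>\<gamma>: "0 \<le> \<alpha>" "\<alpha> < \<gamma>" by auto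
  \<comment> \<open>Below \<open>r1\<close> the mass bound applies; below \<open>1\<close> the
    larger exponent \<open>\<gamma>\<close> gives the smaller power.\<close>
  define r2 where "r2 = min r1 1"
  have r2: "0 < r2" "r2 \<le> 1" "r2 \<le> r1" using \<open>0 < r1\<close> by (auto simp: r2_def)
  \<comment> \<open>No point of \<open>S\<close> is an atom, as \<open>\<gamma> > 0\<close>. This
    serves the covering sets of diameter \<open>0\<close>, since the mass bound requires a positive
    radius.\<close>
  have mass0: "measure P (cball x 0) = 0" if "x \<in> S" for x
  proof -
    have "((\<lambda>r. r powr \<gamma>) \<longlongrightarrow> 0) (at_right 0)" using \<alpha>\<gamma> by real_asymp
    moreover have "\<forall>\<^sub>F r in at_right 0. measure P (cball x 0) \<le> r powr \<gamma>"
      unfolding eventually_at_right_field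
    proof (intro exI[of _ r1] conjI allI impI)
      fix r assume r: "0 < r" "r < r1"
      have "measure P (cball x 0) \<le> measure P (cball x r)"
        using r by (intro finite_measure_mono) (auto simp: sets)
      also have "\<dots> \<le> r powr \<gamma>" using mass that r by auto
      finally show "measure P (cball x 0) \<le> r powr \<gamma>" .
    qed (fact \<open>0 < r1\<close>)
    ultimately have "measure P (cball x 0) \<le> 0" by (rule tendsto_lowerbound) simp
    then show ?thesis using measure_nonneg[of P "cball x 0"] by linarith
  qed
  have "ennreal (r2 powr \<alpha>) \<le> hausdorff_content \<alpha> S"
    unfolding hausdorff_content_def
  proof (rule INF_greatest)
    fix U :: "nat \<Rightarrow> 'a set" assume "U \<in> {U. S \<subseteq> (\<Union>i. U i)}"
    then have cover: "S \<subseteq> (\<Union>i. U i)" by simp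
    \<comment> \<open>Either one covering set is unbounded or has diameter at least
      \<open>r2\<close> and suffices alone, or all nonempty ones are small and the masses are
      compared.\<close>
    show "ennreal (r2 powr \<alpha>) \<le> (\<Sum>i. diam_pow \<alpha> (U i))"
    proof (cases "\<exists>i. U i \<noteq> {} \<and> (bounded (U i) \<longrightarrow> r2 \<le> diameter (U i))")
      case True
      then obtain i where i: "U i \<noteq> {}" "bounded (U i) \<longrightarrow> r2 \<le> diameter (U i)" by blast
      have "ennreal (r2 powr \<alpha>) \<le> diam_pow \<alpha> (U i)"
        using i r2 \<alpha>\<gamma> by (auto simp: diam_pow_def intro!: ennreal_leI powr_mono2)
      also have "\<dots> = (\<Sum>j\<in>{i}. diam_pow \<alpha> (U j))" by simp
      also have "\<dots> \<le> (\<Sum>i. diam_pow \<alpha> (U i))" by (rule sum_le_suminf) auto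
      finally show ?thesis .
    next
      case False
      then have small: "bounded (U i)" "diameter (U i) < r2" if "U i \<noteq> {}" for i
        using that by (metis not_le)+
      \<comment> \<open>The mass bound is available only at centres in \<open>S\<close>, so each set
        meeting \<open>S\<close> is enclosed in a ball about one of its points in \<open>S\<close>,
        with the diameter as radius.\<close>
      define c where "c i = (SOME x. x \<in> U i \<inter> S)" for i
      define V where "V i = (if U i \<inter> S = {} then {} else cball (c i) (diameter (U i)))" for i
      have c: "c i \<in> U i \<inter> S" if "U i \<inter> S \<noteq> {}" for i
        using that unfolding c_def by (intro someI_ex[of "\<lambda>x. x \<in> U i \<inter> S"]) auto
      have VS: "V i \<in> sets P" for i by (simp add: V_def sets)
      have "S \<subseteq> (\<Union>i. V i)"
      proof
        fix x assume x: "x \<in> S"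
        then obtain i where i: "x \<in> U i" using cover by auto
        then have "dist (c i) x \<le> diameter (U i)"
          using c[of i] x small[of i] by (intro diameter_bounded_bound) auto
        then show "x \<in> (\<Union>i. V i)" using x i by (auto simp: V_def intro!: exI[of _ i])
      qed
      then have "1 \<le> emeasure P (\<Union>i. V i)"
        unfolding full[symmetric] using VS by (intro emeasure_mono) auto
      also have "\<dots> \<le> (\<Sum>i. emeasure P (V i))"
        using VS by (intro emeasure_subadditive_countably) auto
      also have "\<dots> \<le> (\<Sum>i. diam_pow \<alpha> (U i))"
      proof (intro suminf_le)
        fix i
        show "emeasure P (V i) \<le> diam_pow \<alpha> (U i)"
        proof (cases "U i \<inter> S = {}")
          case False
          then have ne: "U i \<noteq> {}" and ci: "c i \<in> S" using c[of i] by auto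
          define t where "t = diameter (U i)"
          have t: "0 \<le> t" "t < r2" using diameter_ge_0 small[OF ne] by (auto simp: t_def)
          show ?thesis
          proof (cases "t = 0")
            case True
            then show ?thesis using mass0[OF ci] False
              by (simp add: V_def t_def[symmetric] emeasure_eq_measure)
          next
            case t0: False
            have "measure P (cball (c i) t) \<le> t powr \<gamma>" using mass[OF ci, of t] t t0 r2 by simp
            also have "\<dots> \<le> t powr \<alpha>" using t r2 \<alpha>\<gamma> by (intro powr_mono') auto
            also have "\<dots> = (if \<alpha> = 0 then 1 else t powr \<alpha>)" using t0 by simp
            finally have "ennreal (measure P (cball (c i) t)) \<le> ennreal (if \<alpha> = 0 then 1 else t powr \<alpha>)"
              by (rule ennreal_leI)
            then show ?thesis using False ne small[OF ne]
              by (auto simp: V_def diam_pow_def emeasure_eq_measure t_def split: if_splits)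
          qed
        qed (simp add: V_def)
      qed auto
      finally have "1 \<le> (\<Sum>i. diam_pow \<alpha> (U i))" .
      moreover have "ennreal (r2 powr \<alpha>) \<le> 1"
        using r2 \<alpha>\<gamma> by (simp add: powr_le1)
      ultimately show ?thesis by (rule order_trans[rotated])
    qed
  qed
  then show False using \<alpha> r2 by simp
qed

section \<open>Suprema and infima under uniform convergence\<close>

lemma
  fixes f :: "nat \<Rightarrow> 'a \<Rightarrow> ereal" and g :: "'a \<Rightarrow> real"
  assumes ne: "S \<noteq> {}"
    and unif: "\<And>\<epsilon>. 0 < \<epsilon> \<Longrightarrow> \<forall>\<^sub>F n in sequentially. \<forall>x\<in>S. \<bar>f n x - ereal (g x)\<bar> \<le> ereal \<epsilon>"
  shows tendsto_SUP_abs_diff: "(\<lambda>n. SUP x\<in>S. \<bar>f n x - ereal (g x)\<bar>) \<longlonglongrightarrow> 0"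
    and tendsto_SUP_uniform: "(\<lambda>n. SUP x\<in>S. f n x) \<longlonglongrightarrow> (SUP x\<in>S. ereal (g x))"
proof -
  obtain x0 where x0: "x0 \<in> S" using ne by auto
  show "(\<lambda>n. SUP x\<in>S. \<bar>f n x - ereal (g x)\<bar>) \<longlonglongrightarrow> 0"
  proof (rule order_tendstoI)
    fix a :: ereal assume "a < 0"
    then have "a < (SUP x\<in>S. \<bar>f n x - ereal (g x)\<bar>)" for n
      using x0 by (intro less_le_trans[OF \<open>a < 0\<close> SUP_upper2]) auto
    then show "\<forall>\<^sub>F n in sequentially. a < (SUP x\<in>S. \<bar>f n x - ereal (g x)\<bar>)" by simp
  next
    fix a :: ereal assume "0 < a"
    then obtain e where e: "0 < ereal e" "ereal e < a" using ereal_dense2 by blast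
    from unif[of e] e show "\<forall>\<^sub>F n in sequentially. (SUP x\<in>S. \<bar>f n x - ereal (g x)\<bar>) < a"
      by (auto elim!: eventually_mono intro: le_less_trans[OF SUP_least])
  qed
  show "(\<lambda>n. SUP x\<in>S. f n x) \<longlonglongrightarrow> (SUP x\<in>S. ereal (g x))"
  proof (rule order_tendstoI)
    fix a assume "a < (SUP x\<in>S. ereal (g x))"
    then obtain x where x: "x \<in> S" "a < ereal (g x)" by (auto simp: less_SUP_iff)
    \<comment> \<open>One point with \<open>g x > b > a\<close> suffices: the tolerance
      \<open>g x - b\<close> keeps \<open>f n x\<close>, and hence the supremum, above
      \<open>b\<close>.\<close>
    then obtain b where b: "a < ereal b" "b < g x" using ereal_dense2[of a "g x"] by auto
    from unif[of "g x - b"] b show "\<forall>\<^sub>F n in sequentially. a < (SUP x\<in>S. f n x)"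
    proof (simp, elim eventually_mono)
      fix n assume "\<forall>y\<in>S. \<bar>f n y - ereal (g y)\<bar> \<le> ereal (g x - b)"
      then have "\<bar>f n x - ereal (g x)\<bar> \<le> ereal (g x - b)" using x by blast
      then have "ereal b \<le> f n x" by (cases "f n x") auto
      also have "\<dots> \<le> (SUP x\<in>S. f n x)" using x by (intro SUP_upper)
      finally show "a < (SUP x\<in>S. f n x)" using b by simp
    qed
  next
    fix a assume "(SUP x\<in>S. ereal (g x)) < a"
    \<comment> \<open>Two levels \<open>b < c\<close> are placed between the supremum and
      \<open>a\<close>: all \<open>g x\<close> are below \<open>b\<close>, so the tolerance
      \<open>c - b\<close> keeps every \<open>f n x\<close> at most \<open>c\<close>.\<close>
    then obtain c where c: "(SUP x\<in>S. ereal (g x)) < ereal c" "ereal c < a" using ereal_dense2 by blast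
    then obtain b where b: "(SUP x\<in>S. ereal (g x)) < ereal b" "b < c"
      using ereal_dense2[of "SUP x\<in>S. ereal (g x)" "ereal c"] by auto
    from unif[of "c - b"] b show "\<forall>\<^sub>F n in sequentially. (SUP x\<in>S. f n x) < a"
    proof (simp, elim eventually_mono)
      fix n assume n: "\<forall>x\<in>S. \<bar>f n x - ereal (g x)\<bar> \<le> ereal (c - b)"
      have "f n x \<le> ereal c" if "x \<in> S" for x
      proof -
        have "\<bar>f n x - ereal (g x)\<bar> \<le> ereal (c - b)" "g x < b"
          using n that le_less_trans[OF SUP_upper[OF that] b(1)] by auto
        then show ?thesis by (cases "f n x") auto
      qed
      then have "(SUP x\<in>S. f n x) \<le> ereal c" by (intro SUP_least) auto
      then show "(SUP x\<in>S. f n x) < a" using c by simp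
    qed
  qed
qed

text \<open>The supremum version applied to \<open>- f\<close> and \<open>- g\<close>.\<close>

lemma tendsto_INF_uniform:
  fixes f :: "nat \<Rightarrow> 'a \<Rightarrow> ereal" and g :: "'a \<Rightarrow> real"
  assumes ne: "S \<noteq> {}"
    and unif: "\<And>\<epsilon>. 0 < \<epsilon> \<Longrightarrow> \<forall>\<^sub>F n in sequentially. \<forall>x\<in>S. \<bar>f n x - ereal (g x)\<bar> \<le> ereal \<epsilon>"
  shows "(\<lambda>n. INF x\<in>S. f n x) \<longlonglongrightarrow> (INF x\<in>S. ereal (g x))"
proof -
  have eq: "\<bar>- a - ereal (- b)\<bar> = \<bar>a - ereal b\<bar>" for a b
    by (cases a) auto
  have "(\<lambda>n. SUP x\<in>S. - f n x) \<longlonglongrightarrow> (SUP x\<in>S. ereal (- g x))"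
    using unif by (intro tendsto_SUP_uniform ne) (simp only: eq)
  then have "(\<lambda>n. - (INF x\<in>S. f n x)) \<longlonglongrightarrow> - (INF x\<in>S. ereal (g x))"
    by (simp add: ereal_SUP_uminus_eq flip: uminus_ereal.simps)
  then show ?thesis by (subst ereal_Lim_uminus)
qed

section \<open>Elementary bounds on the pointwise dimension\<close>

lemma pw_dim_est_eq_ereal:
  assumes "0 < empirical X \<omega> n (cball x r)" "0 < r" "r < 1"
  shows "pw_dim_est X \<omega> n r x = ereal (ln (empirical X \<omega> n (cball x r)) / ln r)"
  using assms by (simp add: pw_dim_est_def ext_ln_def)

lemma tendsto_pw_ratio:
  assumes "pw_dim_exists P x"
  shows "((\<lambda>r. ereal (pw_ratio P r x)) \<longlongrightarrow> pw_dim P x) (at_right 0)"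
  using assms unfolding pw_dim_exists_def pw_dim_def by (auto simp: tendsto_Lim)

lemma pw_ratio_nonneg:
  assumes "prob_space P" "0 < r" "r < 1"
  shows "0 \<le> pw_ratio P r x"
proof -
  interpret prob_space P by fact
  \<comment> \<open>A ball of mass \<open>0\<close> is covered by the convention
    \<open>ln 0 = 0\<close>.\<close>
  have "ln (prob (cball x r)) \<le> 0"
    by (cases "prob (cball x r) = 0") (auto simp: zero_less_measure_iff)
  then show ?thesis using assms by (simp add: pw_ratio_def divide_nonpos_neg)
qed

lemma pw_dim_nonneg:
  assumes "prob_space P" "pw_dim_exists P x"
  shows "0 \<le> pw_dim P x"
proof (rule tendsto_lowerbound[OF tendsto_pw_ratio[OF assms(2)]])
  show "\<forall>\<^sub>F r in at_right 0. 0 \<le> ereal (pw_ratio P r x)"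
    using pw_ratio_nonneg[OF assms(1)] by (auto simp: eventually_at_right_field intro!: exI[of _ 1])
qed simp

text \<open>Take logarithms in the mass bound; division by \<open>ln r < 0\<close> reverses the
  inequality, and the contribution of \<open>\<delta>\<close> vanishes in the limit.\<close>

lemma pw_dim_le:
  assumes "pw_dim_exists P x" "0 < r0" "0 < \<delta>"
    and mass: "\<And>r. 0 < r \<Longrightarrow> r < r0 \<Longrightarrow> \<delta> * r powr d' \<le> measure P (cball x r)"
  shows "pw_dim P x \<le> ereal d'"
proof (rule tendsto_le[OF _ _ tendsto_pw_ratio[OF assms(1)]])
  have "((\<lambda>r. (ln \<delta> + d' * ln r) / ln r) \<longlongrightarrow> d') (at_right 0)" by real_asymp
  then show "((\<lambda>r. ereal ((ln \<delta> + d' * ln r) / ln r)) \<longlongrightarrow> ereal d') (at_right 0)" by simp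
  show "\<forall>\<^sub>F r in at_right 0. ereal (pw_ratio P r x) \<le> ereal ((ln \<delta> + d' * ln r) / ln r)"
    unfolding eventually_at_right_field
  proof (intro exI[of _ "min r0 1"] conjI allI impI)
    fix r assume r: "0 < r" "r < min r0 1"
    have "ln \<delta> + d' * ln r = ln (\<delta> * r powr d')" using r \<open>0 < \<delta>\<close> by (simp add: ln_mult ln_powr)
    also have "\<dots> \<le> ln (measure P (cball x r))"
      using mass[of r] r \<open>0 < \<delta>\<close> by (intro ln_mono) auto
    finally show "ereal (pw_ratio P r x) \<le> ereal ((ln \<delta> + d' * ln r) / ln r)"
      using r by (simp add: pw_ratio_def divide_right_mono_neg)
  qed (use \<open>0 < r0\<close> in auto)
qed simp

section \<open>Part (a): consistency at a single point\<close>

lemma eventually_pos_less_of_filterlim_at_right: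
  fixes c :: real
  assumes "filterlim r (at_right 0) F" "0 < c"
  shows "\<forall>\<^sub>F n in F. 0 < r n \<and> r n < c"
proof -
  have "\<forall>\<^sub>F t in at_right 0. 0 < t \<and> t < c"
    using \<open>0 < c\<close> by (auto simp: eventually_at_right_field)
  then show ?thesis by (rule eventually_compose_filterlim[OF _ assms(1)])
qed

theorem (in prob_space) pw_dim_est_consistent:
  fixes X :: "nat \<Rightarrow> 'a \<Rightarrow> 'b::metric_space"
  assumes indep: "indep_vars (\<lambda>_. borel) X UNIV"
    and distr_eq: "\<And>i. distr M borel (X i) = P"
    and exists: "pw_dim_exists P x"
    and pos: "0 < r0" "0 < \<delta>" "0 < d'" and C: "28 / (3 * \<delta>) < C"
    and mass: "\<And>r. 0 < r \<Longrightarrow> r < r0 \<Longrightarrow> \<delta> * r powr d' \<le> measure P (cball x r)"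
  shows "AE \<omega> in M. (\<lambda>n. pw_dim_est X \<omega> n ((C * ln (real n) / real n) powr (1 / d')) x)
    \<longlonglongrightarrow> pw_dim P x"
proof -
  define r where "r n = (C * ln (real n) / real n) powr (1 / d')" for n :: nat
  have C0: "0 < C" using C \<open>0 < \<delta>\<close> by (intro le_less_trans[OF _ C]) simp
  have P: "prob_space P"
    using prob_space_distr[OF random_variable_sample[OF indep distr_eq], of 0] distr_eq by simp
  have r_lim: "filterlim r (at_right 0) sequentially"
    unfolding r_def using C0 \<open>0 < d'\<close> by real_asymp
  note r_ev = eventually_pos_less_of_filterlim_at_right[OF r_lim]
  have bound: "\<forall>\<^sub>F n in sequentially. \<delta> * (C * ln (real n) / real n) \<le> measure P (cball x (r n))"
    using r_ev[OF \<open>0 < r0\<close>] eventually_gt_at_top[of 1]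
  proof eventually_elim
    case (elim n)
    have "r n powr d' = C * ln (real n) / real n"
      using elim C0 \<open>0 < d'\<close> by (simp add: r_def powr_powr)
    then show ?case using mass[of "r n"] elim by simp
  qed
  \<comment> \<open>The threshold on \<open>C\<close> gives \<open>28/3 * 11/72 = 77/54 > 1\<close>.
    The failure probabilities are thus of order \<open>n powr (-s)\<close> with
    \<open>s = 11/72 * (\<delta> * C) > 1\<close>.\<close>
  have s: "1 < 11/72 * (\<delta> * C)"
    using C \<open>0 < \<delta>\<close> by (simp add: field_simps)
  have "AE \<omega> in M. \<forall>\<^sub>F n in sequentially. \<forall>A\<in>{cball x (r n)}.
      measure P A / 2 \<le> empirical X \<omega> n A \<and> empirical X \<omega> n A \<le> 2 * measure P A"
  proof (rule AE_eventually_empirical_comparable[OF indep distr_eq])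
    show "\<forall>\<^sub>F n in sequentially. finite {cball x (r n)} \<and> real (card {cball x (r n)}) \<le> 1
        \<and> (\<forall>A\<in>{cball x (r n)}. A \<in> sets borel \<and> \<delta> * (C * ln (real n) / real n) \<le> measure P A)"
      using bound by simp
    have eq: "exp (- (11/72) * (real n * (\<delta> * (C * ln (real n) / real n)))) = exp (- (11/72 * (\<delta> * C)) * ln (real n))"
      for n by (cases "n = 0") (auto simp: mult_ac)
    show "summable (\<lambda>n. 1 * exp (- (11/72) * (real n * (\<delta> * (C * ln (real n) / real n)))))"
      unfolding eq using summable_exp_minus_ln[OF s] by simp
  qed
  then show ?thesis
  proof (rule AE_mp, intro AE_I2 impI)
    fix \<omega> assume ev: "\<forall>\<^sub>F n in sequentially. \<forall>A\<in>{cball x (r n)}.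
      measure P A / 2 \<le> empirical X \<omega> n A \<and> empirical X \<omega> n A \<le> 2 * measure P A"
    define q where "q n = empirical X \<omega> n (cball x (r n))" for n
    define p where "p n = measure P (cball x (r n))" for n
    have pq: "\<forall>\<^sub>F n in sequentially. 0 < p n \<and> p n / 2 \<le> q n \<and> q n \<le> 2 * p n"
      using ev bound eventually_gt_at_top[of 1]
    proof eventually_elim
      case (elim n)
      have "0 < \<delta> * (C * ln (real n) / real n)" using elim C0 \<open>0 < \<delta>\<close> by simp
      then show ?case using elim by (auto simp: p_def q_def)
    qed
    \<comment> \<open>The masses \<open>p n\<close> and \<open>q n\<close> differ by at most a
      factor \<open>2\<close>, so their logarithms differ by at most \<open>ln 2\<close>, which is
      negligible against \<open>ln (r n)\<close>.\<close>
    have "((\<lambda>t. ln 2 / \<bar>ln t\<bar>) \<longlongrightarrow> 0) (at_right (0::real))" by real_asymp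
    then have lim0: "(\<lambda>n. ln 2 / \<bar>ln (r n)\<bar>) \<longlonglongrightarrow> 0"
      using r_lim by (rule filterlim_compose)
    have "(\<lambda>n. (ln (q n) - ln (p n)) / ln (r n)) \<longlonglongrightarrow> 0"
    proof (rule Lim_null_comparison[OF _ lim0])
      show "\<forall>\<^sub>F n in sequentially. norm ((ln (q n) - ln (p n)) / ln (r n)) \<le> ln 2 / \<bar>ln (r n)\<bar>"
        using pq
      proof eventually_elim
        case (elim n)
        then have "ln (p n / 2) \<le> ln (q n)" "ln (q n) \<le> ln (2 * p n)" by (auto intro!: ln_mono)
        then have "\<bar>ln (q n) - ln (p n)\<bar> \<le> ln 2" using elim by (simp add: ln_mult ln_div abs_le_iff)
        then show ?case by (simp add: divide_right_mono)
      qed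
    qed
    then have "(\<lambda>n. ereal ((ln (q n) - ln (p n)) / ln (r n))) \<longlonglongrightarrow> 0"
      by (simp add: zero_ereal_def)
    moreover have "(\<lambda>n. ereal (pw_ratio P (r n) x)) \<longlonglongrightarrow> pw_dim P x"
      by (rule filterlim_compose[OF tendsto_pw_ratio[OF exists] r_lim])
    \<comment> \<open>The dimension may be \<open>\<infinity>\<close>; its nonnegativity excludes
      \<open>-\<infinity>\<close>, so addition is continuous at the limits.\<close>
    ultimately have "(\<lambda>n. ereal (pw_ratio P (r n) x) + ereal ((ln (q n) - ln (p n)) / ln (r n))) \<longlonglongrightarrow> pw_dim P x + 0"
      using pw_dim_nonneg[OF P exists] by (intro tendsto_add_ereal_nonneg) auto
    moreover have "\<forall>\<^sub>F n in sequentially. pw_dim_est X \<omega> n (r n) x =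
        ereal (pw_ratio P (r n) x) + ereal ((ln (q n) - ln (p n)) / ln (r n))"
      using pq r_ev[OF zero_less_one]
    proof eventually_elim
      case (elim n)
      then have "pw_dim_est X \<omega> n (r n) x = ereal (ln (q n) / ln (r n))"
        unfolding q_def by (intro pw_dim_est_eq_ereal) (auto simp: q_def)
      then show ?case by (simp add: pw_ratio_def p_def diff_divide_distrib)
    qed
    ultimately show "(\<lambda>n. pw_dim_est X \<omega> n ((C * ln (real n) / real n) powr (1 / d')) x) \<longlonglongrightarrow> pw_dim P x"
      unfolding r_def[symmetric] by (simp add: tendsto_cong)
  qed
qed

section \<open>Part (b): consistency uniformly over the support\<close>

lemma uniform_limit_of_tendsto:
  assumes "(h \<longlongrightarrow> L) F"
  shows "uniform_limit S (\<lambda>r x. h r) (\<lambda>x. L) F"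
  using tendstoD[OF assms] by (intro uniform_limitI) auto

text \<open>For small \<open>r\<close> the product is
  \<open>ln (measure P (cball x (c * r))) / ln r\<close>, and \<open>k / ln r\<close> accounts for a
  factor \<open>exp k\<close> in the mass; neither change affects the limit. Boundedness of
  \<open>D\<close> keeps the product of the limits uniform.\<close>

lemma uniform_limit_rescaled_pw_ratio:
  assumes unif: "uniform_limit S (pw_ratio P) D (at_right 0)" and bdd: "bounded (D ` S)" and c: "0 < c"
  shows "uniform_limit S (\<lambda>r x. pw_ratio P (c * r) x * (ln (c * r) / ln r) + k / ln r) D (at_right 0)"
proof -
  have "filterlim (\<lambda>r. c * r) (at_right 0) (at_right 0)" using c by real_asymp
  then have "uniform_limit S (\<lambda>r. pw_ratio P (c * r)) D (at_right 0)"
    using unif by (rule filterlim_compose[rotated])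
  moreover have "((\<lambda>r. ln (c * r) / ln r) \<longlongrightarrow> 1) (at_right 0)"
    and "((\<lambda>r. k / ln r) \<longlongrightarrow> 0) (at_right 0)" using c by real_asymp+
  ultimately have "uniform_limit S (\<lambda>r x. pw_ratio P (c * r) x * (ln (c * r) / ln r) + k / ln r)
      (\<lambda>x. D x * 1 + 0) (at_right 0)"
    using bdd by (intro uniform_limit_add uniform_lim_mult uniform_limit_of_tendsto) (auto simp: image_constant_conv)
  then show ?thesis by simp
qed


text \<open>
  For a centre off a finite net, the empirical mass of its ball is squeezed between the masses of
  concentric balls of slightly smaller and larger radius. Rescaling the radius does not affect
  the dimension, so a union bound over the net replaces a Vapnik-Chervonenkis inequality.
\<close>

theorem (in prob_space) pw_dim_est_uniformly_consistent:
  fixes X :: "nat \<Rightarrow> 'a \<Rightarrow> 'b::metric_space"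
  assumes indep: "indep_vars (\<lambda>_. borel) X UNIV"
    and distr_eq: "\<And>i. distr M borel (X i) = P"
    and pos: "0 < r0" "0 < \<delta>" "0 < d'" "0 < \<beta>"
    and mass: "\<And>x r. x \<in> S \<Longrightarrow> 0 < r \<Longrightarrow> r < r0 \<Longrightarrow> \<delta> * r powr d' \<le> measure P (cball x r)"
    and unif: "uniform_limit S (pw_ratio P) D (at_right 0)"
    and bdd: "bounded (D ` S)"
  shows "AE \<omega> in M. \<forall>\<epsilon>>0. \<forall>\<^sub>F n in sequentially. \<forall>x\<in>S.
    \<bar>pw_dim_est X \<omega> n ((\<beta> * (ln (real n) / real n)) powr (1 / (2 * d'))) x - ereal (D x)\<bar> \<le> ereal \<epsilon>"
proof -
  \<comment> \<open>\<open>u n\<close> is \<open>r n powr d'\<close>, the order of the lower bound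
    on the mass of balls of radius comparable to \<open>r n\<close>.\<close>
  define u where "u n = (\<beta> * (ln (real n) / real n)) powr (1 / 2)" for n :: nat
  define r where "r n = (\<beta> * (ln (real n) / real n)) powr (1 / (2 * d'))" for n :: nat
  have P: "prob_space P" and sets_P: "sets P = sets borel"
    using prob_space_distr[OF random_variable_sample[OF indep distr_eq], of 0] distr_eq[of 0] by auto
  interpret P: prob_space P by (rule P)
  have r_lim: "filterlim r (at_right 0) sequentially"
    unfolding r_def using pos by real_asymp
  have r_powr: "r n powr d' = u n" for n
    using pos by (simp add: r_def u_def powr_powr)
  note r_ev = eventually_pos_less_of_filterlim_at_right[OF r_lim]
  have "\<forall>\<^sub>F n in sequentially. 0 < r n \<and> r n < r0 / 4"
    using pos by (intro r_ev) simp
  then obtain N where N: "\<And>n. n \<ge> N \<Longrightarrow> 0 < r n" "\<And>n. n \<ge> N \<Longrightarrow> r n < r0 / 4"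
    unfolding eventually_sequentially by auto
  \<comment> \<open>Mass at scale \<open>r n / 8\<close> yields a net within distance
    \<open>r n / 4\<close> of every point of \<open>S\<close>.\<close>
  have "\<exists>T. n \<ge> N \<longrightarrow> T \<subseteq> S \<and> finite T \<and> real (card T) \<le> 1 / (\<delta> * (r n / 8) powr d') \<and>
      (\<forall>x\<in>S. \<exists>y\<in>T. dist x y \<le> 2 * (r n / 8))" for n
  proof (cases "n \<ge> N")
    case True
    show ?thesis
      by (rule finite_net_of_ball_mass[OF P sets_P, of "r n / 8" "\<delta> * (r n / 8) powr d'" S])
         (use N[OF True] pos mass in auto)
  qed auto
  then obtain T where T: "\<And>n. n \<ge> N \<Longrightarrow> T n \<subseteq> S" "\<And>n. n \<ge> N \<Longrightarrow> finite (T n)"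
      "\<And>n. n \<ge> N \<Longrightarrow> real (card (T n)) \<le> 1 / (\<delta> * (r n / 8) powr d')"
      "\<And>n x. n \<ge> N \<Longrightarrow> x \<in> S \<Longrightarrow> \<exists>y\<in>T n. dist x y \<le> 2 * (r n / 8)"
    by metis
  \<comment> \<open>Inner and outer comparison balls: the ball of radius \<open>r n\<close> about a
    point of \<open>S\<close> contains one of the former and lies in one of the latter, centred at a
    nearby net point.\<close>
  define \<A> where "\<A> n = (\<lambda>y. cball y (r n / 2)) ` T n \<union> (\<lambda>y. cball y (2 * r n)) ` T n" for n
  \<comment> \<open>Two balls per net point and at most
    \<open>1 / (\<delta> * (r n / 8) powr d')\<close> net points give \<open>K / u n\<close>. The
    mass of an inner ball is at least \<open>c * u n\<close>.\<close>
  define K where "K = 2 * 8 powr d' / \<delta>"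
  define c where "c = \<delta> * (1 / 2) powr d'"
  have c: "0 < c" using pos by (simp add: c_def)
  have "AE \<omega> in M. \<forall>\<^sub>F n in sequentially. \<forall>A\<in>\<A> n.
      measure P A / 2 \<le> empirical X \<omega> n A \<and> empirical X \<omega> n A \<le> 2 * measure P A"
  proof (rule AE_eventually_empirical_comparable[OF indep distr_eq])
    show "\<forall>\<^sub>F n in sequentially. finite (\<A> n) \<and> real (card (\<A> n)) \<le> K / u n
        \<and> (\<forall>A\<in>\<A> n. A \<in> sets borel \<and> c * u n \<le> measure P A)"
      using eventually_ge_at_top[of N]
    proof eventually_elim
      case (elim n)
      note n = N[OF elim] T[OF elim]
      have "card (\<A> n) \<le> card (T n) + card (T n)"
        unfolding \<A>_def using n by (intro order_trans[OF card_Un_le] add_mono card_image_le) auto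
      then have "real (card (\<A> n)) \<le> 2 * (1 / (\<delta> * (r n / 8) powr d'))"
        using n(5) by linarith
      also have "\<dots> = K / u n"
        using n by (simp add: K_def powr_divide r_powr)
      finally have card: "real (card (\<A> n)) \<le> K / u n" .
      have half: "c * u n \<le> measure P (cball y (r n / 2))" if "y \<in> T n" for y
        using mass[of y "r n / 2"] that n pos
        by (auto simp: c_def powr_divide r_powr subset_iff)
      moreover have "measure P (cball y (r n / 2)) \<le> measure P (cball y (2 * r n))" for y
        using n by (intro P.finite_measure_mono) (auto simp: sets_P)
      ultimately have "c * u n \<le> measure P (cball y (2 * r n))" if "y \<in> T n" for y
        using that order_trans by blast
      with card half n show ?case by (auto simp: \<A>_def)
    qed
    have "summable (\<lambda>n. K / u n * exp (- (11/72 * c) * (real n * u n)))"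
      unfolding u_def using c pos by (intro summable_net_tail) auto
    then show "summable (\<lambda>n. K / u n * exp (- (11/72) * (real n * (c * u n))))"
      by (simp add: mult_ac)
  qed
  then show ?thesis
  proof (rule AE_mp, intro AE_I2 impI allI)
    fix \<omega> and \<epsilon> :: real
    assume ev: "\<forall>\<^sub>F n in sequentially. \<forall>A\<in>\<A> n.
      measure P A / 2 \<le> empirical X \<omega> n A \<and> empirical X \<omega> n A \<le> 2 * measure P A" and \<epsilon>: "0 < \<epsilon>"
    \<comment> \<open>\<open>lo\<close> comes from twice the mass of the ball of radius
      \<open>3 * t\<close> and \<open>hi\<close> from half the mass of the ball of radius
      \<open>t / 4\<close>. The larger mass gives the lower value because
      \<open>ln t < 0\<close>.\<close>
    define lo where "lo t x = pw_ratio P (3 * t) x * (ln (3 * t) / ln t) + ln 2 / ln t" for t x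
    define hi where "hi t x = pw_ratio P (1/4 * t) x * (ln (1/4 * t) / ln t) + (- ln 2) / ln t" for t x
    have "uniform_limit S lo D (at_right 0)" "uniform_limit S hi D (at_right 0)"
      unfolding lo_def hi_def by (intro uniform_limit_rescaled_pw_ratio unif bdd; simp)+
    then have "\<forall>\<^sub>F t in at_right 0. \<forall>x\<in>S. dist (lo t x) (D x) < \<epsilon>"
      "\<forall>\<^sub>F t in at_right 0. \<forall>x\<in>S. dist (hi t x) (D x) < \<epsilon>"
      using \<epsilon> by (auto dest: uniform_limitD)
    then have "\<forall>\<^sub>F t in at_right 0. \<forall>x\<in>S. dist (lo t x) (D x) < \<epsilon> \<and> dist (hi t x) (D x) < \<epsilon>"
      by eventually_elim auto
    then have lims: "\<forall>\<^sub>F n in sequentially. \<forall>x\<in>S. dist (lo (r n) x) (D x) < \<epsilon> \<and> dist (hi (r n) x) (D x) < \<epsilon>"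
      by (rule eventually_compose_filterlim[OF _ r_lim])
    show "\<forall>\<^sub>F n in sequentially. \<forall>x\<in>S. \<bar>pw_dim_est X \<omega> n
        ((\<beta> * (ln (real n) / real n)) powr (1 / (2 * d'))) x - ereal (D x)\<bar> \<le> ereal \<epsilon>"
      unfolding r_def[symmetric]
      using ev lims eventually_ge_at_top[of N] r_ev[of "1/3", simplified]
    proof (eventually_elim, intro ballI)
      fix n x assume A: "\<forall>A\<in>\<A> n. measure P A / 2 \<le> empirical X \<omega> n A \<and> empirical X \<omega> n A \<le> 2 * measure P A"
        and lim: "\<forall>x\<in>S. dist (lo (r n) x) (D x) < \<epsilon> \<and> dist (hi (r n) x) (D x) < \<epsilon>"
        and n: "N \<le> n" and "0 < r n \<and> r n * 3 < 1" and x: "x \<in> S"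
      then have r: "0 < r n" "r n < 1/3" "r n < r0" using N(2)[OF n] pos by auto
      define q where "q = empirical X \<omega> n (cball x (r n))"
      obtain y where y: "y \<in> T n" "dist x y \<le> r n / 4" using T(4)[OF n x] by auto
      have ball_mono: "cball a s \<subseteq> cball b t" if "dist a b + s \<le> t" for a b :: 'b and s t
      proof
        fix z assume "z \<in> cball a s"
        then show "z \<in> cball b t" using that dist_triangle2[of b z a] by (simp add: dist_commute)
      qed
      \<comment> \<open>With centres at distance at most \<open>r n / 4\<close>, the radii
        \<open>1/4, 1/2, 1, 2, 3\<close> times \<open>r n\<close> each grow by enough to absorb the
        shift of centre.\<close>
      have sub: "cball x (1/4 * r n) \<subseteq> cball y (r n / 2)" "cball y (r n / 2) \<subseteq> cball x (r n)"
        "cball x (r n) \<subseteq> cball y (2 * r n)" "cball y (2 * r n) \<subseteq> cball x (3 * r n)"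
        using y(2) r by (auto intro!: ball_mono simp: dist_commute)
      have q: "measure P (cball x (1/4 * r n)) / 2 \<le> q" "q \<le> 2 * measure P (cball x (3 * r n))"
      proof -
        have "measure P (cball x (1/4 * r n)) \<le> measure P (cball y (r n / 2))"
          "measure P (cball y (2 * r n)) \<le> measure P (cball x (3 * r n))"
          using sub by (intro P.finite_measure_mono; simp add: sets_P)+
        moreover have "measure P (cball y (r n / 2)) / 2 \<le> empirical X \<omega> n (cball y (r n / 2))"
          "empirical X \<omega> n (cball y (2 * r n)) \<le> 2 * measure P (cball y (2 * r n))"
          using A y(1) by (auto simp: \<A>_def)
        moreover have "empirical X \<omega> n (cball y (r n / 2)) \<le> q" "q \<le> empirical X \<omega> n (cball y (2 * r n))"
          unfolding q_def using sub by (intro empirical_mono; simp)+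
        ultimately show "measure P (cball x (1/4 * r n)) / 2 \<le> q" "q \<le> 2 * measure P (cball x (3 * r n))"
          by linarith+
      qed
      have "0 < \<delta> * (1/4 * r n) powr d'" using r pos by simp
      also have "\<dots> \<le> measure P (cball x (1/4 * r n))" using mass[OF x] r by simp
      finally have m: "0 < measure P (cball x (1/4 * r n))" .
      with q have pos': "0 < q" "0 < measure P (cball x (3 * r n))" by linarith+
      have "ln (measure P (cball x (1/4 * r n)) / 2) \<le> ln q" using q m by (intro ln_mono) auto
      then have lnlo: "ln (measure P (cball x (1/4 * r n))) - ln 2 \<le> ln q"
        using m by (subst (asm) ln_div) auto
      have "ln q \<le> ln (2 * measure P (cball x (3 * r n)))" using q pos' by (intro ln_mono) auto
      then have lnhi: "ln q \<le> ln 2 + ln (measure P (cball x (3 * r n)))"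
        using pos' by (simp add: ln_mult)
      \<comment> \<open>As \<open>3 * r n < 1\<close>, the logarithms of the rescaled radii are
        nonzero and cancel in \<open>lo\<close> and \<open>hi\<close>; division by
        \<open>ln (r n) < 0\<close> reverses the inequalities.\<close>
      have neg: "ln (r n) < 0" "ln (3 * r n) < 0" "ln (1/4 * r n) < 0" using r by simp_all
      have "lo (r n) x = (ln 2 + ln (measure P (cball x (3 * r n)))) / ln (r n)"
        using neg by (simp add: lo_def pw_ratio_def add_divide_distrib)
      also have "\<dots> \<le> ln q / ln (r n)" using lnhi neg by (intro divide_right_mono_neg) auto
      finally have lo: "lo (r n) x \<le> ln q / ln (r n)" .
      have "ln q / ln (r n) \<le> (ln (measure P (cball x (1/4 * r n))) - ln 2) / ln (r n)"
        using lnlo neg by (intro divide_right_mono_neg) auto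
      also have "\<dots> = hi (r n) x"
        using neg by (simp add: hi_def pw_ratio_def diff_divide_distrib)
      finally have hi: "ln q / ln (r n) \<le> hi (r n) x" .
      have "\<bar>lo (r n) x - D x\<bar> < \<epsilon>" "\<bar>hi (r n) x - D x\<bar> < \<epsilon>"
        using lim x by (auto simp: dist_real_def)
      with lo hi have "\<bar>ln q / ln (r n) - D x\<bar> \<le> \<epsilon>" by linarith
      moreover have "pw_dim_est X \<omega> n (r n) x = ereal (ln q / ln (r n))"
        unfolding q_def using r pos' by (intro pw_dim_est_eq_ereal) (auto simp: q_def)
      ultimately show "\<bar>pw_dim_est X \<omega> n (r n) x - ereal (D x)\<bar> \<le> ereal \<epsilon>" by simp
    qed
  qed
qed

section \<open>Both parts combined with the Hausdorff dimension bounds\<close>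

theorem theorem4:
  fixes M :: "'w measure"
    and X :: "nat \<Rightarrow> 'w \<Rightarrow> 'a::euclidean_space"
    and P :: "'a measure"
    and S :: "'a set"
  assumes "prob_space M"
    and "prob_space.indep_vars M (\<lambda>_. borel) X UNIV"
    and "\<And>i. distr M borel (X i) = P"
    and "compact S"
    and "measure_support P = S"
  shows
    "(\<forall>x\<in>S. \<forall>r0>0. \<forall>\<delta>>0. \<forall>d'>0. \<forall>C>28 / (3 * \<delta>).
        pw_dim_exists P x \<longrightarrow>
        (\<forall>r. 0 < r \<and> r < r0 \<longrightarrow> measure P (cball x r) \<ge> \<delta> * r powr d') \<longrightarrow>
        (AE \<omega> in M.
          (\<lambda>n. pw_dim_est X \<omega> n ((C * ln (real n) / real n) powr (1 / d')) x)
            \<longlonglongrightarrow> pw_dim P x))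
     \<and>
     (\<forall>r0>0. \<forall>\<delta>>0. \<forall>d'>0. \<forall>\<beta>>(4 * real DIM('a) + 12) / \<delta>\<^sup>2.
        (\<forall>x\<in>S. \<forall>r. 0 < r \<and> r < r0 \<longrightarrow> measure P (cball x r) \<ge> \<delta> * r powr d') \<longrightarrow>
        (\<forall>x\<in>S. pw_dim_exists P x) \<longrightarrow>
        uniform_limit S (pw_ratio P) (\<lambda>x. real_of_ereal (pw_dim P x)) (at_right 0) \<longrightarrow>
        (let est = (\<lambda>\<omega> n. pw_dim_est X \<omega> n ((\<beta> * (ln (real n) / real n)) powr (1 / (2 * d'))))
         in
          (AE \<omega> in M. (\<lambda>n. SUP x\<in>S. \<bar>est \<omega> n x - pw_dim P x\<bar>) \<longlonglongrightarrow> 0) \<and>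
          (AE \<omega> in M. (\<lambda>n. SUP x\<in>S. est \<omega> n x) \<longlonglongrightarrow> (SUP x\<in>S. pw_dim P x)) \<and>
          (SUP x\<in>S. pw_dim P x) \<ge> hausdorff_dim S \<and>
          (AE \<omega> in M. (\<lambda>n. INF x\<in>S. est \<omega> n x) \<longlonglongrightarrow> (INF x\<in>S. pw_dim P x)) \<and>
          (INF x\<in>S. pw_dim P x) \<le> hausdorff_dim S))"
  proof (intro conjI)
  interpret prob_space M by fact
  note indep = assms(2) and distr_eq = assms(3)
  show "\<forall>x\<in>S. \<forall>r0>0. \<forall>\<delta>>0. \<forall>d'>0. \<forall>C>28 / (3 * \<delta>).
        pw_dim_exists P x \<longrightarrow>
        (\<forall>r. 0 < r \<and> r < r0 \<longrightarrow> measure P (cball x r) \<ge> \<delta> * r powr d') \<longrightarrow>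
        (AE \<omega> in M.
          (\<lambda>n. pw_dim_est X \<omega> n ((C * ln (real n) / real n) powr (1 / d')) x)
            \<longlonglongrightarrow> pw_dim P x)"
    using pw_dim_est_consistent[OF indep distr_eq] by blast
  show "\<forall>r0>0. \<forall>\<delta>>0. \<forall>d'>0. \<forall>\<beta>>(4 * real DIM('a) + 12) / \<delta>\<^sup>2.
        (\<forall>x\<in>S. \<forall>r. 0 < r \<and> r < r0 \<longrightarrow> measure P (cball x r) \<ge> \<delta> * r powr d') \<longrightarrow>
        (\<forall>x\<in>S. pw_dim_exists P x) \<longrightarrow>
        uniform_limit S (pw_ratio P) (\<lambda>x. real_of_ereal (pw_dim P x)) (at_right 0) \<longrightarrow>
        (let est = (\<lambda>\<omega> n. pw_dim_est X \<omega> n ((\<beta> * (ln (real n) / real n)) powr (1 / (2 * d'))))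
         in
          (AE \<omega> in M. (\<lambda>n. SUP x\<in>S. \<bar>est \<omega> n x - pw_dim P x\<bar>) \<longlonglongrightarrow> 0) \<and>
          (AE \<omega> in M. (\<lambda>n. SUP x\<in>S. est \<omega> n x) \<longlonglongrightarrow> (SUP x\<in>S. pw_dim P x)) \<and>
          (SUP x\<in>S. pw_dim P x) \<ge> hausdorff_dim S \<and>
          (AE \<omega> in M. (\<lambda>n. INF x\<in>S. est \<omega> n x) \<longlonglongrightarrow> (INF x\<in>S. pw_dim P x)) \<and>
          (INF x\<in>S. pw_dim P x) \<le> hausdorff_dim S)"
    unfolding Let_def
  proof (intro allI impI)
    fix r0 \<delta> d' \<beta> :: real
    assume pos: "0 < r0" "0 < \<delta>" "0 < d'" and \<beta>: "(4 * real DIM('a) + 12) / \<delta>\<^sup>2 < \<beta>"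
      and mass: "\<forall>x\<in>S. \<forall>r. 0 < r \<and> r < r0 \<longrightarrow> \<delta> * r powr d' \<le> measure P (cball x r)"
      and ex: "\<forall>x\<in>S. pw_dim_exists P x"
      and unif: "uniform_limit S (pw_ratio P) (\<lambda>x. real_of_ereal (pw_dim P x)) (at_right 0)"
    define D where "D x = real_of_ereal (pw_dim P x)" for x
    have \<beta>0: "0 < \<beta>" using pos by (intro le_less_trans[OF _ \<beta>]) simp
    have P: "prob_space P" and sets_P: "sets P = sets borel"
      using prob_space_distr[OF random_variable_sample[OF indep distr_eq], of 0] distr_eq[of 0] by auto
    interpret P: prob_space P by (rule P)
    \<comment> \<open>The mass bound confines the dimension to \<open>[0, d']\<close>, so
      \<open>real_of_ereal\<close> loses nothing and \<open>D\<close> is bounded.\<close>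
    have pw: "pw_dim P x = ereal (D x)" "0 \<le> D x" "D x \<le> d'" if "x \<in> S" for x
    proof -
      have "0 \<le> pw_dim P x" "pw_dim P x \<le> ereal d'"
        using pw_dim_nonneg[OF P] pw_dim_le[of P x r0 \<delta> d'] ex that pos mass by auto
      then show "pw_dim P x = ereal (D x)" "0 \<le> D x" "D x \<le> d'"
        by (cases "pw_dim P x"; auto simp: D_def)+
    qed
    have unif': "uniform_limit S (pw_ratio P) D (at_right 0)"
      using unif by (simp add: D_def[abs_def])
    have bdd: "bounded (D ` S)"
      using pw by (intro boundedI[of _ d']) auto
    have S_borel: "S \<in> sets borel" using \<open>compact S\<close> by (intro borel_closed compact_imp_closed)
    have S_full: "emeasure P S = 1"
    proof -
      have "S \<in> sets P" "space P = UNIV" "- S \<in> sets P"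
        using S_borel sets_P sets_eq_imp_space_eq[OF sets_P] borel_comp[of S] by auto
      then have "AE x in P. x \<in> S"
        using emeasure_measure_support_compl[OF sets_P] \<open>measure_support P = S\<close>
        by (intro AE_I[of _ _ "- S"]) auto
      then show ?thesis using \<open>S \<in> sets P\<close> by (simp add: P.emeasure_eq_measure P.prob_eq_1)
    qed
    then have ne: "S \<noteq> {}" by auto
    have conv: "AE \<omega> in M. \<forall>\<epsilon>>0. \<forall>\<^sub>F n in sequentially. \<forall>x\<in>S.
      \<bar>pw_dim_est X \<omega> n ((\<beta> * (ln (real n) / real n)) powr (1 / (2 * d'))) x - ereal (D x)\<bar> \<le> ereal \<epsilon>"
      using mass by (intro pw_dim_est_uniformly_consistent[OF indep distr_eq pos \<beta>0 _ unif' bdd]) auto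
    have SUP_eq: "(SUP x\<in>S. pw_dim P x) = (SUP x\<in>S. ereal (D x))"
      and INF_eq: "(INF x\<in>S. pw_dim P x) = (INF x\<in>S. ereal (D x))"
      and abs_eq: "\<And>f. (SUP x\<in>S. \<bar>f x - pw_dim P x\<bar>) = (SUP x\<in>S. \<bar>f x - ereal (D x)\<bar>)"
      using pw by (auto intro!: SUP_cong INF_cong)
    \<comment> \<open>Positivity allows the mass to be recovered from its logarithm below, as
      \<open>exp (ln p) = p\<close> fails at \<open>p = 0\<close>.\<close>
    have pos_mass: "0 < measure P (cball x r)" if "x \<in> S" "0 < r" for x r
    proof -
      have "0 < emeasure P (ball x r)"
        using that \<open>measure_support P = S\<close> by (auto simp: measure_support_def)
      also have "\<dots> \<le> emeasure P (cball x r)"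
        by (intro emeasure_mono) (auto simp: sets_P)
      finally show ?thesis by (simp add: P.emeasure_eq_measure)
    qed
    have ratio: "\<exists>r1>0. r1 < 1 \<and> (\<forall>r x. 0 < r \<longrightarrow> r < r1 \<longrightarrow> x \<in> S \<longrightarrow> \<bar>pw_ratio P r x - D x\<bar> < \<epsilon>)"
      if \<epsilon>: "0 < \<epsilon>" for \<epsilon>
    proof -
      obtain b where "0 < b" "\<forall>r>0. r < b \<longrightarrow> (\<forall>x\<in>S. dist (pw_ratio P r x) (D x) < \<epsilon>)"
        using uniform_limitD[OF unif' \<epsilon>] unfolding eventually_at_right_field by auto
      then show ?thesis by (intro exI[of _ "min b (1/2)"]) (auto simp: dist_real_def)
    qed
    have powr_le: "r powr a \<le> measure P (cball x r)" if "x \<in> S" "0 < r" "r < 1" "pw_ratio P r x \<le> a" for x r a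
    proof -
      have "a * ln r \<le> ln (measure P (cball x r))"
        using that by (simp add: pw_ratio_def neg_divide_le_eq)
      then have "exp (a * ln r) \<le> exp (ln (measure P (cball x r)))" by simp
      then show ?thesis using pos_mass[of x r] that by (simp add: powr_def)
    qed
    have powr_ge: "measure P (cball x r) \<le> r powr a" if "x \<in> S" "0 < r" "r < 1" "a \<le> pw_ratio P r x" for x r a
    proof -
      have "ln (measure P (cball x r)) \<le> a * ln r"
        using that by (simp add: pw_ratio_def neg_le_divide_eq)
      then have "exp (ln (measure P (cball x r))) \<le> exp (a * ln r)" by simp
      then show ?thesis using pos_mass[of x r] that by (simp add: powr_def)
    qed
    \<comment> \<open>For \<open>c > b\<close> above the supremum of \<open>D\<close>, uniform
      convergence pushes the ratio below \<open>c\<close> at all small radii. This gives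
      \<open>r powr c \<le> measure P (cball x r)\<close> with a threshold \<open>r1\<close> common
      to all points, as the covering argument requires.\<close>
    have upper: "hausdorff_dim S \<le> (SUP x\<in>S. ereal (D x))"
    proof (rule dense_ge)
      fix z assume "(SUP x\<in>S. ereal (D x)) < z"
      then obtain c where c: "(SUP x\<in>S. ereal (D x)) < ereal c" "ereal c < z" using ereal_dense2 by blast
      then obtain b where b: "(SUP x\<in>S. ereal (D x)) < ereal b" "b < c"
        using ereal_dense2[of "SUP x\<in>S. ereal (D x)" "ereal c"] by auto
      have Db: "D x < b" if "x \<in> S" for x using le_less_trans[OF SUP_upper[OF that] b(1)] by simp
      have "0 \<le> c" using ne Db pw(2) b(2) by force
      obtain r1 where r1: "0 < r1" "r1 < 1" "\<And>r x. 0 < r \<Longrightarrow> r < r1 \<Longrightarrow> x \<in> S \<Longrightarrow> \<bar>pw_ratio P r x - D x\<bar> < c - b"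
        using ratio[of "c - b"] b(2) by auto
      have "hausdorff_dim S \<le> ereal c"
      proof (rule hausdorff_dim_le_of_ball_mass[OF P sets_P \<open>0 \<le> c\<close> r1(1)])
        fix x r assume "x \<in> S" "0 < r" "r < r1"
        then show "r powr c \<le> measure P (cball x r)"
          using r1(2) r1(3)[of r x] Db[of x] by (intro powr_le) auto
      qed
      then show "hausdorff_dim S \<le> z" using c by simp
    qed
    \<comment> \<open>Symmetrically, \<open>c < b\<close> below the infimum gives
      \<open>measure P (cball x r) \<le> r powr c\<close>, the hypothesis of the mass distribution
      principle.\<close>
    have lower: "(INF x\<in>S. ereal (D x)) \<le> hausdorff_dim S"
    proof (rule dense_le)
      fix z assume "z < (INF x\<in>S. ereal (D x))"
      then obtain c where c: "ereal c < (INF x\<in>S. ereal (D x))" "z < ereal c" using ereal_dense2 by blast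
      then obtain b where b: "ereal b < (INF x\<in>S. ereal (D x))" "c < b"
        using ereal_dense2[of "ereal c" "INF x\<in>S. ereal (D x)"] by auto
      have Db: "b < D x" if "x \<in> S" for x using less_le_trans[OF b(1) INF_lower[OF that]] by simp
      obtain r1 where r1: "0 < r1" "r1 < 1" "\<And>r x. 0 < r \<Longrightarrow> r < r1 \<Longrightarrow> x \<in> S \<Longrightarrow> \<bar>pw_ratio P r x - D x\<bar> < b - c"
        using ratio[of "b - c"] b(2) by auto
      have "ereal c \<le> hausdorff_dim S"
      proof (rule hausdorff_dim_ge_of_ball_mass[OF P sets_P S_full S_borel r1(1)])
        fix x r assume "x \<in> S" "0 < r" "r < r1"
        then show "measure P (cball x r) \<le> r powr c"
          using r1(2) r1(3)[of r x] Db[of x] by (intro powr_ge) auto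
      qed
      then show "z \<le> hausdorff_dim S" using c by simp
    qed
    show "(AE \<omega> in M. (\<lambda>n. SUP x\<in>S. \<bar>pw_dim_est X \<omega> n ((\<beta> * (ln (real n) / real n)) powr (1 / (2 * d'))) x - pw_dim P x\<bar>) \<longlonglongrightarrow> 0) \<and>
          (AE \<omega> in M. (\<lambda>n. SUP x\<in>S. pw_dim_est X \<omega> n ((\<beta> * (ln (real n) / real n)) powr (1 / (2 * d'))) x) \<longlonglongrightarrow> (SUP x\<in>S. pw_dim P x)) \<and>
          (SUP x\<in>S. pw_dim P x) \<ge> hausdorff_dim S \<and>
          (AE \<omega> in M. (\<lambda>n. INF x\<in>S. pw_dim_est X \<omega> n ((\<beta> * (ln (real n) / real n)) powr (1 / (2 * d'))) x) \<longlonglongrightarrow> (INF x\<in>S. pw_dim P x)) \<and>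
          (INF x\<in>S. pw_dim P x) \<le> hausdorff_dim S"
      unfolding SUP_eq INF_eq abs_eq
    proof (intro conjI upper lower)
      note AE = AE_mp[OF conv AE_I2]
      show "AE \<omega> in M. (\<lambda>n. SUP x\<in>S. \<bar>pw_dim_est X \<omega> n ((\<beta> * (ln (real n) / real n)) powr (1 / (2 * d'))) x - ereal (D x)\<bar>) \<longlonglongrightarrow> 0"
        by (rule AE, rule impI, rule tendsto_SUP_abs_diff[OF ne]) simp
      show "AE \<omega> in M. (\<lambda>n. SUP x\<in>S. pw_dim_est X \<omega> n ((\<beta> * (ln (real n) / real n)) powr (1 / (2 * d'))) x) \<longlonglongrightarrow> (SUP x\<in>S. ereal (D x))"
        by (rule AE, rule impI, rule tendsto_SUP_uniform[OF ne]) simp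
      show "AE \<omega> in M. (\<lambda>n. INF x\<in>S. pw_dim_est X \<omega> n ((\<beta> * (ln (real n) / real n)) powr (1 / (2 * d'))) x) \<longlonglongrightarrow> (INF x\<in>S. ereal (D x))"
        by (rule AE, rule impI, rule tendsto_INF_uniform[OF ne]) simp
    qed
  qed
qed

end
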